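(* Let $R$ be a finite idempotent semiring. Then the category $\mathrm{Rel}(R)$ is dimension zero over $F$ for every infinite field $F$; that is, every finitely generated representation of $\mathrm{Rel}(R)$ over $F$ has finite length.
   Context: A finite idempotent semiring is a finite set $R$ with two binary operations $+$ and $*$ such that: $+$ is commutative, associative and idempotent ($a+a=a$ for all $a\in R$) and there is an additive identity $0\in R$; $*$ is associative (not necessarily commutative) and there is a multiplicative identity $1\in R$; $*$ distributes over $+$ (on both sides); and $0*a=a*0=0$ for all $a\in R$. The category $\mathrm{Rel}(R)$: its objects are the whole numbers (nonnegative integers). For whole numbers $x,y$, a morphism from $x$ to $y$ is an $x\times y$ matrix with entries in $R$. Composition is matrix multiplication: for $A=(a_{i,j})\in\mathrm{Hom}(x,y)$ and $B=(b_{i,j})\in\mathrm{Hom}(y,z)$, $B\circ A = AB = \left(\sum_{k=1}^{y} a_{i,k}*b_{k,j}\right)\in\mathrm{Hom}(x,z)$. The identity morphism of $x$ is the $x\times x$ matrix with diagonal entries $1$ and all other entries $0$. Let $\mathscr{D}$ be a category and $F$ a field. A representation of $\mathscr{D}$ over $F$ is a functor $V$ from $\mathscr{D}$ to the category $\mathrm{Vect}_F$ of $F$-vector spaces (of arbitrary dimension) and linear maps. A subrepresentation of $V$ is a representation $W$ such that $W(d)$ is a vector subspace of $V(d)$ for every object $d$ and $W(f)$ is the restriction of $V(f)$ to $W(d)$ for every morphism $f:d\to d'$. A representation $V$ is finitely generated if there exist finitely many objects $d_1,\dots,d_i$ and, for each $k$, finitely many vectors $v_{k,1},\dots,v_{k,j_k}\in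 V(d_k)$ such that any subrepresentation $W$ of $V$ with $v_{k,l}\in W(d_k)$ for all $k,l$ equals $V$. A representation $V$ is finite length if every non-repetitive chain of subrepresentations of $V$ is finite (equivalently, $V$ has a finite composition series $0=W_0\subsetneq\cdots\subsetneq W_n=V$ with each $W_{i+1}/W_i$ irreducible, i.e. nonzero with no subrepresentations other than zero and itself). The category $\mathscr{D}$ is dimension zero over $F$ if every finitely generated representation of $\mathscr{D}$ over $F$ is finite length. *)

theory Defs
  imports "Jordan_Normal_Form.VS_Connect"
begin

text \<open>Idempotent semirings. The library class \<open>semiring_1\<close> is not used here because it excludes the
  one-element semiring, by requiring \<open>0 \<noteq> 1\<close>.\<close>

class idempotent_semiring = semiring_0 + monoid_mult +
  assumes add_idem: "a + a = a"


text \<open>Every element of the type \<open>'o\<close> is an object, and a morphism determines its source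
  and target. \<open>Cmp D g f\<close> is \<open>g \<circ> f\<close> (first \<open>f\<close>, then \<open>g\<close>).\<close>

record ('o, 'm) category =
  Hom :: "'o \<Rightarrow> 'o \<Rightarrow> 'm set"
  Idt :: "'o \<Rightarrow> 'm"
  Cmp :: "'m \<Rightarrow> 'm \<Rightarrow> 'm"

locale category =
  fixes D :: "('o, 'm) category"
  assumes Hom_disjoint: "f \<in> Hom D x y \<Longrightarrow> f \<in> Hom D x' y' \<Longrightarrow> x = x' \<and> y = y'"
    and Idt_Hom: "Idt D x \<in> Hom D x x"
    and Cmp_Hom: "f \<in> Hom D x y \<Longrightarrow> g \<in> Hom D y z \<Longrightarrow> Cmp D g f \<in> Hom D x z"
    and Cmp_Idt_right: "f \<in> Hom D x y \<Longrightarrow> Cmp D f (Idt D x) = f"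
    and Cmp_Idt_left: "f \<in> Hom D x y \<Longrightarrow> Cmp D (Idt D y) f = f"
    and Cmp_assoc: "f \<in> Hom D w x \<Longrightarrow> g \<in> Hom D x y \<Longrightarrow> h \<in> Hom D y z \<Longrightarrow>
      Cmp D h (Cmp D g f) = Cmp D (Cmp D h g) f"


definition Rel :: "(nat, 'r::idempotent_semiring mat) category" where
  "Rel = \<lparr>Hom = carrier_mat, Idt = 1\<^sub>m, Cmp = (\<lambda>B A. A * B)\<rparr>"

lemma category_Rel: "category (Rel :: (nat, 'r::idempotent_semiring mat) category)"
proof
  fix f g h :: "'r mat" and w x y z x' y' :: nat
  show "x = x' \<and> y = y'" if "f \<in> Hom Rel x y" "f \<in> Hom Rel x' y'"
    using that by (auto simp: Rel_def)
  show "Idt Rel x \<in> Hom (Rel :: (nat, 'r mat) category) x x"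
    by (simp add: Rel_def)
  show "Cmp Rel g f \<in> Hom Rel x z" if "f \<in> Hom Rel x y" "g \<in> Hom Rel y z"
    using that by (simp add: Rel_def)
  show "Cmp Rel f (Idt Rel x) = f" if "f \<in> Hom Rel x y"
    using that
    by (auto simp: Rel_def scalar_prod_def if_distrib[where f = "\<lambda>a. a * b" for b] intro!: eq_matI
        cong: if_cong)
  show "Cmp Rel (Idt Rel y) f = f" if "f \<in> Hom Rel x y"
    using that
    by (auto simp: Rel_def scalar_prod_def if_distrib[where f = "\<lambda>a. b * a" for b] intro!: eq_matI
        cong: if_cong)
  show "Cmp Rel h (Cmp Rel g f) = Cmp Rel (Cmp Rel h g) f"
    if "f \<in> Hom Rel w x" "g \<in> Hom Rel x y" "h \<in> Hom Rel y z"
    using that by (simp add: Rel_def)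
qed


text \<open>Each object is sent to a vector space of its own (possibly infinite-dimensional); the
  underlying sets are subsets of one type \<open>'v\<close>, but the vector space structures on them
  are unrelated.\<close>

record ('o, 'm, 'k, 'v) rep =
  Space :: "'o \<Rightarrow> ('k, 'v) module"
  Map :: "'m \<Rightarrow> 'v \<Rightarrow> 'v"

locale representation = category D
  for D :: "('o, 'm) category" +
  fixes K :: "'k ring" and V :: "('o, 'm, 'k, 'v) rep"
  assumes Space_vectorspace: "vectorspace K (Space V x)"
    and Map_linear: "f \<in> Hom D x y \<Longrightarrow> linear_map K (Space V x) (Space V y) (Map V f)"
    and Map_Idt: "v \<in> carrier (Space V x) \<Longrightarrow> Map V (Idt D x) v = v"
    and Map_Cmp: "f \<in> Hom D x y \<Longrightarrow> g \<in> Hom D y z \<Longrightarrow> v \<in> carrier (Space V x) \<Longrightarrow>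
      Map V (Cmp D g f) v = Map V g (Map V f v)"

definition restrict_rep ::
    "('o, 'm, 'k, 'v) rep \<Rightarrow> ('o \<Rightarrow> 'v set) \<Rightarrow> ('o, 'm, 'k, 'v) rep" where
  "restrict_rep V W = \<lparr>Space = (\<lambda>x. (Space V x)\<lparr>carrier := W x\<rparr>), Map = Map V\<rparr>"

text \<open>Operations and maps of a subrepresentation are those of \<open>V\<close>, so it is given by its
  underlying sets.\<close>

definition subrepresentation ::
    "('o, 'm) category \<Rightarrow> 'k ring \<Rightarrow> ('o, 'm, 'k, 'v) rep \<Rightarrow> ('o \<Rightarrow> 'v set) \<Rightarrow> bool" where
  "subrepresentation D K V W \<longleftrightarrow>
    (\<forall>x. VectorSpace.subspace K (W x) (Space V x)) \<and> representation D K (restrict_rep V W)"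

lemma (in representation) subrepresentation_iff:
  "subrepresentation D K V W \<longleftrightarrow>
    (\<forall>x. VectorSpace.subspace K (W x) (Space V x)) \<and>
    (\<forall>x y. \<forall>f\<in>Hom D x y. Map V f ` W x \<subseteq> W y)"
  (is "_ \<longleftrightarrow> ?S \<and> ?I")
proof
  assume "subrepresentation D K V W"
  then have S: ?S and R: "representation D K (restrict_rep V W)"
    by (auto simp: subrepresentation_def)
  have "Map V f v \<in> W y" if "f \<in> Hom D x y" "v \<in> W x" for f x y v
    using linear_map.T_im[OF representation.Map_linear[OF R that(1)], of v] that(2)
    by (simp add: restrict_rep_def)
  with S show "?S \<and> ?I" by blast
next
  assume A: "?S \<and> ?I"
  have sub: "W x \<subseteq> carrier (Space V x)" for x
    using A by (meson VectorSpace.subspace.submod submodule.subset)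
  have vs: "vectorspace K ((Space V x)\<lparr>carrier := W x\<rparr>)" for x
    using vectorspace.subspace_is_vs[OF Space_vectorspace] A by blast
  have "linear_map K ((Space V x)\<lparr>carrier := W x\<rparr>) ((Space V y)\<lparr>carrier := W y\<rparr>) (Map V f)"
    if f: "f \<in> Hom D x y" for f x y
  proof -
    interpret L: linear_map K "Space V x" "Space V y" "Map V f"
      by (rule Map_linear[OF f])
    have "Map V f \<in> LinearCombinations.module_hom K ((Space V x)\<lparr>carrier := W x\<rparr>) ((Space V y)\<lparr>carrier := W y\<rparr>)"
      using A f sub[of x] L.f_hom unfolding LinearCombinations.module_hom_def
      by (auto simp: Pi_iff subset_iff image_subset_iff)
    then show ?thesis
      using vs by (simp add: linear_map_def mod_hom_def mod_hom_axioms_def vectorspace_def)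
  qed
  moreover have "Map V (Cmp D g f) v = Map V g (Map V f v)"
    if "f \<in> Hom D x y" "g \<in> Hom D y z" "v \<in> W x" for f g x y z v
    using that sub Map_Cmp by blast
  moreover have "Map V (Idt D x) v = v" if "v \<in> W x" for x v
    using that sub Map_Idt by blast
  ultimately have "representation D K (restrict_rep V W)"
    using vs category_axioms
    by (auto simp: representation_def representation_axioms_def restrict_rep_def)
  with A show "subrepresentation D K V W" by (simp add: subrepresentation_def)
qed

definition finitely_generated ::
    "('o, 'm) category \<Rightarrow> 'k ring \<Rightarrow> ('o, 'm, 'k, 'v) rep \<Rightarrow> bool" where
  "finitely_generated D K V \<longleftrightarrow>
    (\<exists>S. finite S \<and> (\<forall>(x, v)\<in>S. v \<in> carrier (Space V x)) \<and>
      (\<forall>W. subrepresentation D K V W \<and> (\<forall>(x, v)\<in>S. v \<in> W x) \<longrightarrow>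
        (\<forall>x. W x = carrier (Space V x))))"

text \<open>Here \<open>(\<le>)\<close> on \<open>'o \<Rightarrow> 'v set\<close> is objectwise inclusion. A chain is a set, hence without
  repetitions.\<close>

definition finite_length ::
    "('o, 'm) category \<Rightarrow> 'k ring \<Rightarrow> ('o, 'm, 'k, 'v) rep \<Rightarrow> bool" where
  "finite_length D K V \<longleftrightarrow>
    (\<forall>C. C \<subseteq> {W. subrepresentation D K V W} \<and> Complete_Partial_Order.chain (\<le>) C \<longrightarrow> finite C)"

text \<open>HOL cannot quantify over types inside a definition, so the type \<open>'v\<close> that contains the
  underlying sets of the representations is a parameter; it is to be read as arbitrary.\<close>

definition dimension_zero ::
    "('o, 'm) category \<Rightarrow> 'k ring \<Rightarrow> 'v itself \<Rightarrow> bool" where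
  "dimension_zero D K _ \<longleftrightarrow>
    (\<forall>V :: ('o, 'm, 'k, 'v) rep.
      representation D K V \<and> finitely_generated D K V \<longrightarrow> finite_length D K V)"

end

theory Submission
  imports Defs
begin

text \<open>
  A finitely generated representation \<open>V\<close> grows at most geometrically: \<open>V(z)\<close> is spanned by the
  images of the finitely many generators under all matrices, of which there are at most
  \<open>n ^ z\<close> per generator for a constant \<open>n\<close> that depends on \<open>R\<close> and on the degrees of the
  generators. On the other hand, a subquotient of \<open>V\<close> that begins in degree \<open>y\<close> grows at least
  like \<open>y ^ z\<close>. Hence no subquotient begins in a degree above \<open>n\<close>; that is, two nested
  subrepresentations that agree in the degrees \<open>\<le> n\<close> are equal. Along a chain, the sum of
  the dimensions in these finitely many degrees is then a strictly increasing, bounded quantity, so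
  the chain is finite.

  The lower bound is the heart of the matter (\<open>growth_of_subquotient\<close>). Since
  \<open>1 + 1 = 1\<close>, matrices with entries \<open>0\<close> and \<open>1\<close> multiply like relations, whatever \<open>R\<close> is.
  Let \<open>W \<le> W'\<close> agree below \<open>y\<close> but not at \<open>y\<close>, and call a vector negligible if it lies in \<open>W\<close>.
  A matrix on \<open>y\<close> that factors through a smaller object makes all of \<open>W'(y)\<close> negligible.
  Choose a maximal reflexive relation \<open>T\<close> on \<open>{..<y}\<close> that does not do so, and \<open>v\<close> in \<open>W'(y)\<close>
  such that \<open>w = T v\<close> is not negligible.
  By maximality every reflexive relation either fixes \<open>w\<close> or makes it negligible, and it
  does the former exactly if it is contained in the inclusion order on the columns of \<open>T\<close>. These
  columns are distinct, since otherwise \<open>T\<close> would factor.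

  A function \<open>f\<close> from \<open>{..<z}\<close> to \<open>{..<y}\<close>, extended by the identity to \<open>y + z\<close> points, gives a
  vector \<open>u f\<close> in \<open>W'(y + z)\<close> by duplicating coordinates of \<open>w\<close>. The
  largest relation from \<open>y + z\<close> back to \<open>y\<close> that takes \<open>u f\<close> to \<open>w\<close> makes \<open>u g\<close> negligible unless
  \<open>g \<le> f\<close> pointwise in the column order. So the \<open>y ^ z\<close> vectors \<open>u f\<close> are related to their
  detectors by a triangular system, and are linearly independent.
\<close>


section \<open>Linear algebra\<close>

text \<open>The support of a nontrivial relation is a set in which every vector depends on the others, so
  to refute dependence it suffices to separate, by a subspace, one well-chosen vector of each
  finite set from the rest of that set.\<close>

lemma (in vectorspace) lin_dep_circuit:
  assumes "S \<subseteq> carrier V" and "lin_dep S"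
  obtains B where "finite B" "B \<noteq> {}" "B \<subseteq> S" "\<And>u. u \<in> B \<Longrightarrow> u \<in> span (B - {u})"
proof -
  obtain A a v where A: "finite A" "A \<subseteq> S" "a \<in> A \<rightarrow> carrier K" "lincomb a A = \<zero>\<^bsub>V\<^esub>"
    and v: "v \<in> A" "a v \<noteq> \<zero>\<^bsub>K\<^esub>"
    using assms(2) unfolding lin_dep_def by blast
  define B where "B = {u \<in> A. a u \<noteq> \<zero>\<^bsub>K\<^esub>}"
  have B: "finite B" "B \<subseteq> A" "B \<subseteq> carrier V" "a \<in> B \<rightarrow> carrier K"
    using A assms(1) by (auto simp: B_def)
  have "lincomb a (B \<union> (A - B)) = lincomb a B"
    using A B assms(1) by (intro lincomb_clean) (auto simp: B_def)
  moreover have "B \<union> (A - B) = A"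
    using B by auto
  ultimately have "lincomb a B = \<zero>\<^bsub>V\<^esub>"
    using A by simp
  then have "u \<in> span (B - {u})" if "u \<in> B" for u
    using that B by (intro lincomb_isolate(2)[of B a]) (auto simp: B_def)
  then show ?thesis
    using that[of B] B v A(2) by (auto simp: B_def)
qed

text \<open>The maximal number of independent vectors serves as a dimension that is defined directly on
  the subsets of the ambient space.\<close>

lemma (in vectorspace) subspace_height:
  assumes "fin_dim"
  obtains h :: "'c set \<Rightarrow> nat" where
    "\<And>W. VectorSpace.subspace K W V \<Longrightarrow> h W \<le> dim"
    "\<And>W W'. VectorSpace.subspace K W V \<Longrightarrow> VectorSpace.subspace K W' V \<Longrightarrow> W \<subset> W' \<Longrightarrow> h W < h W'"
proof -
  define I where "I W = {A. A \<subseteq> W \<and> lin_indpt A}" for W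
  define h where "h W = Max (card ` I W)" for W
  have sub: "W \<subseteq> carrier V" if "VectorSpace.subspace K W V" for W
    using that by (meson VectorSpace.subspace.submod submodule.subset)
  have indpt: "finite A" "card A \<le> dim" if "A \<in> I W" "VectorSpace.subspace K W V" for A W
    using li_le_dim[OF assms, of A] that sub[OF that(2)] by (auto simp: I_def)
  have fin: "finite (card ` I W)" if "VectorSpace.subspace K W V" for W
  proof (rule finite_subset)
    show "card ` I W \<subseteq> {..dim}"
      using indpt(2) that by blast
  qed simp
  have "lin_indpt {}"
    by (simp add: lin_dep_def)
  then have ne: "card ` I W \<noteq> {}" for W
    by (auto simp: I_def)
  show ?thesis
  proof (rule that[of h])
    show "h W \<le> dim" if "VectorSpace.subspace K W V" for W
      unfolding h_def using Max_in[OF fin[OF that] ne] indpt(2) that by auto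
  next
    fix W W' assume W: "VectorSpace.subspace K W V" and W': "VectorSpace.subspace K W' V" and less: "W \<subset> W'"
    obtain A where A: "A \<in> I W" "card A = h W"
      using Max_in[OF fin[OF W] ne] by (auto simp: h_def)
    obtain v where v: "v \<in> W'" "v \<notin> W"
      using less by blast
    have "span A \<subseteq> W"
      using A(1) W by (intro span_is_subset) (auto simp: I_def)
    then have "lin_indpt (A \<union> {v})"
      using lin_dep_iff_in_span[of A v] A(1) v sub[OF W] sub[OF W'] by (auto simp: I_def)
    then have "A \<union> {v} \<in> I W'"
      using A(1) v less by (auto simp: I_def)
    then have "card (A \<union> {v}) \<le> h W'"
      unfolding h_def by (intro Max_ge fin[OF W']) blast
    moreover have "card (A \<union> {v}) = Suc (h W)"
      using A v indpt(1)[OF A(1) W] by (subst card_Un_disjoint) (auto simp: I_def)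
    ultimately show "h W < h W'"
      by simp
  qed
qed

lemma linear_preimage_subspace:
  assumes "linear_map K V V' T" and "VectorSpace.subspace K W V'"
  shows "VectorSpace.subspace K {v \<in> carrier V. T v \<in> W} V"
proof -
  interpret linear_map K V V' T by fact
  interpret W: submodule K W V'
    using assms(2) by (simp add: VectorSpace.subspace_def)
  have "submodule K {v \<in> carrier V. T v \<in> W} V"
    by unfold_locales auto
  then show ?thesis
    by (simp add: VectorSpace.subspace_def V.vectorspace_axioms)
qed


section \<open>Boolean matrices over an idempotent semiring\<close>

lemma card_carrier_mat_le:
  "finite (carrier_mat x z :: 'r::finite mat set)"
  "card (carrier_mat x z :: 'r::finite mat set) \<le> card (UNIV :: 'r set) ^ (x * z)"
proof -
  let ?I = "{..<x} \<times> {..<z}"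
  have eq: "(carrier_mat x z :: 'r mat set) \<subseteq> (\<lambda>f. mat x z f) ` (?I \<rightarrow>\<^sub>E UNIV)"
  proof
    fix A :: "'r mat" assume A: "A \<in> carrier_mat x z"
    then have "A = mat x z (restrict (($$) A) ?I)"
      by (intro eq_matI) auto
    then show "A \<in> (\<lambda>f. mat x z f) ` (?I \<rightarrow>\<^sub>E UNIV)"
      by (rule image_eqI[where x = "restrict (($$) A) ?I"]) auto
  qed
  have fin: "finite (?I \<rightarrow>\<^sub>E (UNIV :: 'r set))"
    by (intro finite_PiE) auto
  have card: "card (?I \<rightarrow>\<^sub>E (UNIV :: 'r set)) = card (UNIV :: 'r set) ^ (x * z)"
    by (subst card_PiE) auto
  show "finite (carrier_mat x z :: 'r mat set)"
    using eq fin by (blast intro: finite_subset)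
  show "card (carrier_mat x z :: 'r mat set) \<le> card (UNIV :: 'r set) ^ (x * z)"
    using card_mono[OF _ eq] card_image_le[OF fin, of "mat x z"] fin card by simp
qed

definition bool_mat :: "nat \<Rightarrow> nat \<Rightarrow> (nat \<times> nat) set \<Rightarrow> 'r::idempotent_semiring mat" where
  "bool_mat x y Q = mat x y (\<lambda>p. if p \<in> Q then 1 else 0)"

lemma bool_mat_carrier [simp]: "bool_mat x y Q \<in> carrier_mat x y"
  by (simp add: bool_mat_def)

text \<open>This is where \<open>1 + 1 = 1\<close> enters: sums of truth values are disjunctions.\<close>

lemma idempotent_sum_indicator:
  assumes "finite A"
  shows "(\<Sum>k\<in>A. if P k then 1 else 0 :: 'r::idempotent_semiring) = (if \<exists>k\<in>A. P k then 1 else 0)"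
  using assms by (induction A rule: finite_induct) (auto simp: add_idem)

lemma bool_mat_mult:
  assumes "Q \<subseteq> UNIV \<times> {..<y}"
  shows "(bool_mat x y Q * bool_mat y z Q' :: 'r::idempotent_semiring mat) = bool_mat x z (Q O Q')"
proof (rule eq_matI)
  fix i j assume "i < dim_row (bool_mat x z (Q O Q') :: 'r mat)"
    and "j < dim_col (bool_mat x z (Q O Q') :: 'r mat)"
  then have ij: "i < x" "j < z" by (auto simp: bool_mat_def)
  have "(bool_mat x y Q * bool_mat y z Q' :: 'r mat) $$ (i, j)
      = (\<Sum>k<y. (if (i, k) \<in> Q then 1 else 0) * (if (k, j) \<in> Q' then 1 else 0))"
    using ij by (simp add: bool_mat_def scalar_prod_def atLeast0LessThan)
  also have "\<dots> = (\<Sum>k<y. if (i, k) \<in> Q \<and> (k, j) \<in> Q' then 1 else 0)"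
    by (intro sum.cong) auto
  also have "\<dots> = bool_mat x z (Q O Q') $$ (i, j)"
    using ij assms by (subst idempotent_sum_indicator) (auto simp: bool_mat_def)
  finally show "(bool_mat x y Q * bool_mat y z Q' :: 'r mat) $$ (i, j)
      = bool_mat x z (Q O Q') $$ (i, j)" .
qed (auto simp: bool_mat_def)

text \<open>Delete one of two equal columns; the second factor puts back the copy.\<close>

lemma bool_mat_equal_columns_factor:
  assumes T: "T \<subseteq> UNIV \<times> {..<y}" and ij: "i < y" "j < y" "i \<noteq> j"
    and col: "\<And>l. (l, i) \<in> T \<longleftrightarrow> (l, j) \<in> T"
  shows "\<exists>A B. A \<in> carrier_mat y (y - 1) \<and> B \<in> carrier_mat (y - 1) y \<and>
    (bool_mat y y T :: 'r::idempotent_semiring mat) = A * B"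
proof -
  have "card ({..<y} - {j}) = y - 1"
    using ij by simp
  then obtain e where e: "bij_betw e {..<y - 1} ({..<y} - {j})"
    using ex_bij_betw_nat_finite[of "{..<y} - {j}"] by (auto simp: atLeast0LessThan)
  define P where "P = {(l, k). k < y - 1 \<and> (l, e k) \<in> T}"
  define Q where "Q = {(k, l). l < y \<and> e k = (if l = j then i else l)}"
  have "(l, m) \<in> P O Q \<longleftrightarrow> (l, m) \<in> T" for l m
  proof
    assume "(l, m) \<in> P O Q"
    then show "(l, m) \<in> T"
      using col by (auto simp: P_def Q_def split: if_splits)
  next
    assume lm: "(l, m) \<in> T"
    let ?m = "if m = j then i else m"
    have "?m \<in> {..<y} - {j}" "(l, ?m) \<in> T" "m < y"
      using lm T ij col by auto
    moreover obtain k where "k < y - 1" "e k = ?m"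
      using e calculation(1) by (metis bij_betw_iff_bijections lessThan_iff)
    ultimately show "(l, m) \<in> P O Q"
      by (auto simp: P_def Q_def)
  qed
  then have "P O Q = T" by auto
  then have "bool_mat y y T = bool_mat y (y - 1) P * bool_mat (y - 1) y Q"
    by (subst bool_mat_mult) (auto simp: P_def)
  then show ?thesis
    by (metis bool_mat_carrier)
qed


section \<open>Growth of representations of the matrix category\<close>

locale Rel_representation =
  representation "Rel :: (nat, 'r::{finite, idempotent_semiring} mat) category" K V
  for K :: "'k ring" and V :: "(nat, 'r::{finite, idempotent_semiring} mat, 'k, 'v) rep"
begin

lemma Map_mat_linear:
  "A \<in> carrier_mat x y \<Longrightarrow> linear_map K (Space V x) (Space V y) (Map V A)"
  by (rule Map_linear) (simp add: Rel_def)

lemma Map_closed: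
  assumes "A \<in> carrier_mat x y" and "v \<in> carrier (Space V x)"
  shows "Map V A v \<in> carrier (Space V y)"
  using linear_map.T_im[OF Map_mat_linear] assms by blast

lemma Map_mult:
  assumes "A \<in> carrier_mat x y" and "B \<in> carrier_mat y z" and "v \<in> carrier (Space V x)"
  shows "Map V (A * B) v = Map V B (Map V A v)"
  using Map_Cmp[of A x y B z v] assms by (simp add: Rel_def)

lemma Map_one: "v \<in> carrier (Space V x) \<Longrightarrow> Map V (1\<^sub>m x) v = v"
  using Map_Idt[of v x] by (simp add: Rel_def)

lemma subrepresentation_mats:
  "subrepresentation Rel K V W \<longleftrightarrow>
    (\<forall>x. VectorSpace.subspace K (W x) (Space V x)) \<and>
    (\<forall>x y. \<forall>A\<in>carrier_mat x y. Map V A ` W x \<subseteq> W y)"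
  unfolding subrepresentation_iff by (simp add: Rel_def)

lemma subrepresentation_subset:
  assumes "subrepresentation Rel K V W"
  shows "W x \<subseteq> carrier (Space V x)"
  using assms by (meson subrepresentation_mats VectorSpace.subspace.submod submodule.subset)

text \<open>The lower bound on growth: in the quotient of \<open>W'\<close> by \<open>W\<close>, which begins in degree \<open>y\<close>, there
  are \<open>y ^ z\<close> vectors of degree \<open>y + z\<close> that are independent modulo \<open>W\<close>. Only independence in \<open>V\<close>
  is recorded, because that is what the upper bound contradicts.\<close>

lemma growth_of_subquotient:
  assumes W: "subrepresentation Rel K V W" and W': "subrepresentation Rel K V W'"
    and below: "\<And>x. x < y \<Longrightarrow> W' x \<subseteq> W x" and differ: "\<not> W' y \<subseteq> W y"
  shows "\<exists>S \<subseteq> carrier (Space V (y + z)). finite S \<and> card S = y ^ z \<and>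
    \<not> module.lin_dep K (Space V (y + z)) S"
proof -
  interpret X: vectorspace K "Space V (y + z)"
    by (rule Space_vectorspace)
  have W_Map: "Map V A u \<in> W y'" if "A \<in> carrier_mat x y'" "u \<in> W x" for A x y' u
    using W that unfolding subrepresentation_mats by blast
  have W'_Map: "Map V A u \<in> W' y'" if "A \<in> carrier_mat x y'" "u \<in> W' x" for A x y' u
    using W' that unfolding subrepresentation_mats by blast
  note W'_sub = subrepresentation_subset[OF W']
  let ?act = "\<lambda>x y' Q. Map V (bool_mat x y' Q)"
  have act_O: "?act x y' Q' (?act x' x Q u) = ?act x' y' (Q O Q') u"
    if "Q \<subseteq> UNIV \<times> {..<x}" "u \<in> carrier (Space V x')" for x x' y' Q Q' u
    using Map_mult[of "bool_mat x' x Q" x' x "bool_mat x y' Q'" y' u] that(2)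
    by (simp add: bool_mat_mult[OF that(1)])

  \<comment> \<open>The identity relation qualifies, so a maximal \<open>T\<close> exists. Composing with a reflexive relation
    can only enlarge \<open>T\<close>, so the result is either \<open>T\<close> again or makes \<open>v\<close> negligible.\<close>
  define \<T> where "\<T> = {T. T \<subseteq> {..<y} \<times> {..<y} \<and> (\<forall>i<y. (i, i) \<in> T) \<and>
    (\<exists>v\<in>W' y. ?act y y T v \<notin> W y)}"
  have "\<T> \<subseteq> Pow ({..<y} \<times> {..<y})"
    by (auto simp: \<T>_def)
  then have "finite \<T>"
    by (rule finite_subset) simp
  moreover have "\<T> \<noteq> {}"
  proof -
    obtain v where v: "v \<in> W' y" "v \<notin> W y"
      using differ by blast
    have "bool_mat y y (Id_on {..<y}) = (1\<^sub>m y :: 'r mat)"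
      by (intro eq_matI) (auto simp: bool_mat_def)
    then have "?act y y (Id_on {..<y}) v = v"
      using v W'_sub Map_one by auto
    then have "Id_on {..<y} \<in> \<T>"
      using v by (auto simp: \<T>_def intro!: bexI[of _ v])
    then show ?thesis by blast
  qed
  ultimately obtain T where T: "T \<in> \<T>" and max: "\<And>T'. T' \<in> \<T> \<Longrightarrow> T \<subseteq> T' \<Longrightarrow> T = T'"
    using finite_has_maximal[of \<T>] by blast
  have T_sub: "T \<subseteq> {..<y} \<times> {..<y}" and T_refl: "\<And>i. i < y \<Longrightarrow> (i, i) \<in> T"
    using T by (auto simp: \<T>_def)
  then have T_sub': "T \<subseteq> UNIV \<times> {..<y}" by auto
  obtain v where v: "v \<in> W' y" and v_out: "?act y y T v \<notin> W y"
    using T by (auto simp: \<T>_def)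
  have v_car: "v \<in> carrier (Space V y)"
    using v W'_sub by blast
  define w where "w = ?act y y T v"
  have w: "w \<in> carrier (Space V y)" "w \<notin> W y"
    using v_out v_car by (auto simp: w_def intro: Map_closed[OF bool_mat_carrier])

  have fixes_w: "?act y y Q w = w" if "T O Q = T" for Q
    using act_O[OF T_sub' v_car, of y Q] that by (simp add: w_def)
  have kills_w: "?act y y Q w \<in> W y" if "Q \<subseteq> {..<y} \<times> {..<y}" "T \<subset> T O Q" for Q
  proof (rule ccontr)
    assume "\<not> ?thesis"
    then have "?act y y (T O Q) v \<notin> W y"
      using act_O[OF T_sub' v_car, of y Q] by (simp add: w_def)
    then have "T O Q \<in> \<T>"
      using v T_refl T_sub that by (auto simp: \<T>_def)
    then show False
      using max that(2) by blast
  qed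

  \<comment> \<open>Inclusion of columns is the largest relation \<open>Q\<close> with \<open>T O Q = T\<close>. It is antisymmetric, as a
    repeated column would let \<open>T\<close> factor through \<open>y - 1\<close>, where \<open>W'\<close> lies in \<open>W\<close>.\<close>
  define col where "col j = {l. (l, j) \<in> T}" for j
  have col_inj: "i = j" if ij: "i < y" "j < y" and eq: "col i = col j" for i j
  proof (rule ccontr)
    assume "i \<noteq> j"
    then obtain A B :: "'r mat" where AB: "A \<in> carrier_mat y (y - 1)" "B \<in> carrier_mat (y - 1) y"
      and factor: "bool_mat y y T = A * B"
      using bool_mat_equal_columns_factor[OF T_sub' ij, where ?'r = 'r] eq by (auto simp: col_def)
    have "Map V A v \<in> W (y - 1)"
      using W'_Map[OF AB(1) v] below[of "y - 1"] ij by auto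
    then have "w \<in> W y"
      using W_Map[OF AB(2)] Map_mult[OF AB v_car] factor by (simp add: w_def)
    with w show False by blast
  qed

  \<comment> \<open>Extending \<open>f\<close> by the identity makes every composite \<open>graph g O test f\<close> reflexive, so that
    the dichotomy for reflexive relations applies. Without the identity part, permutations
    would come in.\<close>
  define F where "F = {..<z} \<rightarrow>\<^sub>E {..<y}"
  define ext where "ext f k = (if k < y then k else f (k - y))" for f :: "nat \<Rightarrow> nat" and k
  define graph where "graph f = {(ext f k, k) | k. k < y + z}" for f
  define test where "test f = {(k, j). k < y + z \<and> j < y \<and> col (ext f k) \<subseteq> col j}" for f
  define u where "u f = ?act y (y + z) (graph f) w" for f
  have ext_less: "ext f k < y" if "f \<in> F" "k < y + z" for f k
    using that by (auto simp: ext_def F_def PiE_def Pi_def)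
  have test_u: "?act (y + z) y (test f) (u g) = ?act y y (graph g O test f) w" for f g
    unfolding u_def using w(1) by (intro act_O) (auto simp: graph_def)

  have hit: "?act (y + z) y (test f) (u f) = w" if f: "f \<in> F" for f
  proof -
    have "T O (graph f O test f) = T"
    proof
      show "T O (graph f O test f) \<subseteq> T"
        by (auto simp: graph_def test_def col_def)
      show "T \<subseteq> T O (graph f O test f)"
      proof
        fix p assume p: "p \<in> T"
        then obtain l j where lj: "p = (l, j)" "j < y" using T_sub by auto
        then have "(j, j) \<in> graph f" "(j, j) \<in> test f"
          by (auto simp: graph_def test_def ext_def intro!: exI[of _ j])
        then show "p \<in> T O (graph f O test f)" using p lj by blast
      qed
    qed
    then show ?thesis
      by (simp add: test_u fixes_w)
  qed
  have miss: "?act (y + z) y (test f) (u g) \<in> W y"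
    if f: "f \<in> F" and g: "g \<in> F" and k: "k < z" "\<not> col (g k) \<subseteq> col (f k)" for f g k
  proof -
    let ?Q = "graph g O test f"
    have "T \<subseteq> T O ?Q"
    proof
      fix p assume p: "p \<in> T"
      then obtain l j where lj: "p = (l, j)" "j < y" using T_sub by auto
      then have "(j, j) \<in> graph g" "(j, j) \<in> test f"
        by (auto simp: graph_def test_def ext_def intro!: exI[of _ j])
      then show "p \<in> T O ?Q" using p lj by blast
    qed
    moreover obtain l where l: "(l, g k) \<in> T" "(l, f k) \<notin> T"
      using k(2) by (auto simp: col_def)
    have "(g k, y + k) \<in> graph g" "(y + k, f k) \<in> test f"
      using k(1) ext_less[OF f, of "y + k"]
      by (auto simp: graph_def test_def ext_def intro!: exI[of _ "y + k"])
    then have "(l, f k) \<in> T O ?Q" using l by blast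
    ultimately have "T \<subset> T O ?Q" using l by blast
    moreover have "?Q \<subseteq> {..<y} \<times> {..<y}"
      using ext_less[OF g] by (auto simp: graph_def test_def)
    ultimately show ?thesis
      by (simp add: test_u kills_w)
  qed
  have F_eqI: "f = g" if "f \<in> F" "g \<in> F" "\<And>k. k < z \<Longrightarrow> col (f k) = col (g k)" for f g
  proof (rule PiE_ext[of f "{..<z}" "\<lambda>_. {..<y}"])
    show "f k = g k" if "k \<in> {..<z}" for k
      using col_inj[of "f k" "g k"] that \<open>f \<in> F\<close> \<open>g \<in> F\<close> \<open>\<And>k. k < z \<Longrightarrow> col (f k) = col (g k)\<close>
      by (auto simp: F_def)
  qed (use that in \<open>auto simp: F_def\<close>)
  have fin_F: "finite F" and card_F: "card F = y ^ z"
    by (auto simp: F_def card_PiE intro: finite_PiE)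
  have "inj_on u F"
  proof (rule inj_onI, rule F_eqI)
    fix f g k assume fg: "f \<in> F" "g \<in> F" "u f = u g" and k: "k < z"
    show "col (f k) = col (g k)"
      using miss[OF fg(1,2) k] miss[OF fg(2,1) k] hit[OF fg(1)] hit[OF fg(2)] fg(3) w(2) by auto
  qed
  then have card: "card (u ` F) = y ^ z"
    by (simp add: card_image card_F)
  have u_car: "u f \<in> carrier (Space V (y + z))" for f
    using w(1) by (auto simp: u_def intro: Map_closed[OF bool_mat_carrier])
  have "\<not> X.lin_dep (u ` F)"
  proof
    assume "X.lin_dep (u ` F)"
    then obtain B where B: "finite B" "B \<noteq> {}" "B \<subseteq> u ` F"
      and circuit: "\<And>b. b \<in> B \<Longrightarrow> b \<in> X.span (B - {b})"
      using X.lin_dep_circuit[of "u ` F"] u_car by blast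
    \<comment> \<open>Independence by triangularity: test at a minimal \<open>f\<close> among the functions in the circuit.\<close>
    define G where "G = {f \<in> F. u f \<in> B}"
    define less where "less g f \<longleftrightarrow> g \<noteq> f \<and> g \<in> F \<and> f \<in> F \<and> (\<forall>k<z. col (g k) \<subseteq> col (f k))" for g f
    have anti: "f = g" if "f \<in> F" "g \<in> F" "\<forall>k<z. col (f k) \<subseteq> col (g k)" "\<forall>k<z. col (g k) \<subseteq> col (f k)" for f g
      using that by (intro F_eqI) auto
    have "asymp_on G less"
      by (rule asymp_onI) (use anti in \<open>auto simp: less_def\<close>)
    moreover have "transp_on G less"
    proof (rule transp_onI)
      fix f g h assume "less f g" "less g h"
      then show "less f h"
        using anti[of f g] unfolding less_def by blast
    qed
    moreover have "finite G" "G \<noteq> {}"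
      using fin_F B by (auto simp: G_def)
    ultimately obtain f where f: "f \<in> G" and min: "\<forall>g\<in>G. g \<noteq> f \<longrightarrow> \<not> less g f"
      using Finite_Set.bex_min_element[of G less] by blast
    let ?pre = "{b \<in> carrier (Space V (y + z)). ?act (y + z) y (test f) b \<in> W y}"
    have pre: "VectorSpace.subspace K ?pre (Space V (y + z))"
      using W by (intro linear_preimage_subspace[OF Map_mat_linear]) (auto simp: subrepresentation_mats)
    have "B - {u f} \<subseteq> ?pre"
    proof
      fix b assume b: "b \<in> B - {u f}"
      then obtain g where g: "g \<in> F" "b = u g" using B(3) by blast
      then have "g \<in> G" "g \<noteq> f" using b by (auto simp: G_def)
      then have "\<not> less g f" using min by blast
      then obtain k where "k < z" "\<not> col (g k) \<subseteq> col (f k)"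
        using g f \<open>g \<noteq> f\<close> by (auto simp: less_def G_def)
      then show "b \<in> ?pre"
        using miss[of f g k] g f u_car by (auto simp: G_def)
    qed
    then have "X.span (B - {u f}) \<subseteq> ?pre"
      using pre by (intro X.span_is_subset) auto
    then have "?act (y + z) y (test f) (u f) \<in> W y"
      using circuit[of "u f"] f by (auto simp: G_def)
    then show False
      using hit[of f] f w(2) by (auto simp: G_def)
  qed
  then show ?thesis
    using card fin_F u_car by (intro exI[of _ "u ` F"]) auto
qed

text \<open>The span of the images of the generators is already a subrepresentation. The base \<open>n\<close> is
  \<open>card R\<close> to the power \<open>m\<close>, where \<open>m\<close> bounds the degrees of the generators.\<close>

lemma finitely_generated_dim_bound:
  assumes "finitely_generated Rel K V"
  shows "\<exists>n c. n > 0 \<and>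
    (\<forall>z. vectorspace.fin_dim K (Space V z) \<and> vectorspace.dim K (Space V z) \<le> c * n ^ z)"
proof -
  obtain S where S: "finite S" "\<And>x v. (x, v) \<in> S \<Longrightarrow> v \<in> carrier (Space V x)"
    and gen: "\<And>W z. subrepresentation Rel K V W \<Longrightarrow> (\<And>x v. (x, v) \<in> S \<Longrightarrow> v \<in> W x) \<Longrightarrow>
      W z = carrier (Space V z)"
    using assms unfolding finitely_generated_def by fast
  define G where "G z = (\<Union>(x, v)\<in>S. (\<lambda>A. Map V A v) ` carrier_mat x z)" for z
  define W where "W z = LinearCombinations.module.span K (Space V z) (G z)" for z
  have G_car: "G z \<subseteq> carrier (Space V z)" for z
    using S(2) by (auto simp: G_def intro: Map_closed)
  have G_sub: "G z \<subseteq> W z" for z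
  proof -
    interpret vectorspace K "Space V z" by (rule Space_vectorspace)
    show ?thesis unfolding W_def by (rule in_own_span[OF G_car])
  qed
  have W_sub: "VectorSpace.subspace K (W z) (Space V z)" for z
  proof -
    interpret vectorspace K "Space V z" by (rule Space_vectorspace)
    show ?thesis unfolding W_def by (rule span_is_subspace[OF G_car])
  qed
  have W_Map: "Map V A ` W x \<subseteq> W y" if A: "A \<in> carrier_mat x y" for A x y
  proof -
    interpret vectorspace K "Space V x" by (rule Space_vectorspace)
    let ?pre = "{v \<in> carrier (Space V x). Map V A v \<in> W y}"
    have pre: "VectorSpace.subspace K ?pre (Space V x)"
      by (intro linear_preimage_subspace[OF Map_mat_linear[OF A]] W_sub)
    have "G x \<subseteq> ?pre"
    proof
      fix b assume b: "b \<in> G x"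
      then obtain x' v A' where v: "(x', v) \<in> S" "A' \<in> carrier_mat x' x" "b = Map V A' v"
        by (auto simp: G_def)
      then have "Map V A b = Map V (A' * A) v"
        using Map_mult[OF v(2) A] S(2) by simp
      moreover have "A' * A \<in> carrier_mat x' y"
        using v(2) A by simp
      ultimately have "Map V A b \<in> G y"
        using v(1) by (auto simp: G_def)
      then show "b \<in> ?pre"
        using b G_car G_sub by blast
    qed
    then have "W x \<subseteq> ?pre"
      unfolding W_def[of x] using pre by (intro span_is_subset) auto
    then show ?thesis by blast
  qed
  have span: "W z = carrier (Space V z)" for z
  proof (rule gen)
    show "subrepresentation Rel K V W"
      using W_sub W_Map by (auto simp: subrepresentation_mats)
    show "v \<in> W x" if "(x, v) \<in> S" for x v
    proof -
      have "Map V (1\<^sub>m x) v \<in> G x"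
        using that by (force simp: G_def)
      then show ?thesis
        using Map_one S(2)[OF that] G_sub by auto
    qed
  qed
  define q where "q = card (UNIV :: 'r set)"
  define m where "m = Max (insert 0 (fst ` S))"
  have q: "q > 0"
    by (simp add: q_def card_gt_0_iff)
  have card_G: "card (G z) \<le> card S * (q ^ m) ^ z" and fin_G: "finite (G z)" for z
  proof -
    show "finite (G z)"
      using S(1) card_carrier_mat_le(1) by (auto simp: G_def)
    have "card (G z) \<le> (\<Sum>s\<in>S. card (case s of (x, v) \<Rightarrow> (\<lambda>A. Map V A v) ` (carrier_mat x z :: 'r mat set)))"
      unfolding G_def by (rule card_UN_le[OF S(1)])
    also have "\<dots> \<le> (\<Sum>s\<in>S. (q ^ m) ^ z)"
    proof (rule sum_mono)
      fix s assume s: "s \<in> S"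
      obtain x v where xv: "s = (x, v)" by force
      have "x \<le> m"
        using s xv S(1) by (force simp: m_def intro: Max_ge)
      then have "q ^ (x * z) \<le> q ^ (m * z)"
        using q by (intro power_increasing) auto
      moreover have "card ((\<lambda>A. Map V A v) ` (carrier_mat x z :: 'r mat set)) \<le> q ^ (x * z)"
        unfolding q_def
        by (rule le_trans[OF card_image_le[OF card_carrier_mat_le(1)] card_carrier_mat_le(2)])
      ultimately show "card (case s of (x, v) \<Rightarrow> (\<lambda>A. Map V A v) ` (carrier_mat x z :: 'r mat set)) \<le> (q ^ m) ^ z"
        by (simp add: xv power_mult)
    qed
    finally show "card (G z) \<le> card S * (q ^ m) ^ z" by simp
  qed
  show ?thesis
  proof (intro exI conjI allI)
    show "q ^ m > 0" using q by simp
    show "vectorspace.fin_dim K (Space V z)" for z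
    proof -
      interpret vectorspace K "Space V z" by (rule Space_vectorspace)
      show ?thesis
        unfolding fin_dim_def using fin_G[of z] G_car[of z] span[of z] unfolding W_def by blast
    qed
    show "vectorspace.dim K (Space V z) \<le> card S * (q ^ m) ^ z" for z
    proof -
      interpret vectorspace K "Space V z" by (rule Space_vectorspace)
      have "dim \<le> card (G z)"
        using span fin_G G_car by (intro gen_ge_dim) (auto simp: W_def)
      then show ?thesis using card_G[of z] by simp
    qed
  qed
qed

text \<open>At the least degree \<open>y\<close> of disagreement, \<open>y ^ z \<le> c * n ^ (y + z)\<close> for all \<open>z\<close>, which fails
  for large \<open>z\<close> if \<open>y > n\<close>.\<close>

lemma finitely_generated_determined_below:
  assumes "finitely_generated Rel K V"
  obtains n where "\<And>W W'. subrepresentation Rel K V W \<Longrightarrow> subrepresentation Rel K V W' \<Longrightarrow>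
    (\<And>x. x \<le> n \<Longrightarrow> W' x \<subseteq> W x) \<Longrightarrow> W' \<le> W"
proof -
  obtain n c where n: "n > 0" and fin_V: "\<And>z. vectorspace.fin_dim K (Space V z)"
    and dim_V: "\<And>z. vectorspace.dim K (Space V z) \<le> c * n ^ z"
    using finitely_generated_dim_bound[OF assms] by metis
  show ?thesis
  proof (rule that[of n], rule ccontr)
    fix W W' assume W: "subrepresentation Rel K V W" and W': "subrepresentation Rel K V W'"
      and below: "\<And>x. x \<le> n \<Longrightarrow> W' x \<subseteq> W x" and "\<not> W' \<le> W"
    then have ex: "\<exists>y. \<not> W' y \<subseteq> W y" by (auto simp: le_fun_def)
    define y where "y = (LEAST y. \<not> W' y \<subseteq> W y)"
    have y: "\<not> W' y \<subseteq> W y" "\<And>x. x < y \<Longrightarrow> W' x \<subseteq> W x"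
      using LeastI_ex[OF ex] not_less_Least unfolding y_def by blast+
    have "n < y"
      using y(1) below by (meson not_le)
    have le: "y ^ z \<le> c * n ^ y * n ^ z" for z
    proof -
      interpret vectorspace K "Space V (y + z)" by (rule Space_vectorspace)
      obtain S where S: "S \<subseteq> carrier (Space V (y + z))" "card S = y ^ z" "lin_indpt S"
        using growth_of_subquotient[OF W W' y(2,1)] by blast
      have "y ^ z \<le> dim"
        using li_le_dim(2)[OF fin_V S(1,3)] S(2) by simp
      also have "\<dots> \<le> c * n ^ y * n ^ z"
        using dim_V[of "y + z"] by (simp add: power_add mult.assoc)
      finally show ?thesis .
    qed
    \<comment> \<open>As \<open>y > n\<close>, the powers of \<open>y / n\<close> exceed the constant \<open>c * n ^ y\<close>.\<close>
    have "1 < real y / real n"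
      using \<open>n < y\<close> n by simp
    then obtain z where "real (c * n ^ y) < (real y / real n) ^ z"
      using real_arch_pow by blast
    then have "real (c * n ^ y) * real n ^ z < real y ^ z"
      using n by (simp add: power_divide field_simps)
    then have "c * n ^ y * n ^ z < y ^ z"
      by (metis of_nat_less_iff of_nat_mult of_nat_power)
    with le[of z] show False by simp
  qed
qed

lemma finitely_generated_finite_length:
  assumes "finitely_generated Rel K V"
  shows "finite_length Rel K V"
  unfolding finite_length_def
proof (intro allI impI, elim conjE)
  fix C assume sub: "C \<subseteq> {W. subrepresentation Rel K V W}"
    and chain: "Complete_Partial_Order.chain (\<le>) C"
  obtain n where det: "\<And>W W'. subrepresentation Rel K V W \<Longrightarrow> subrepresentation Rel K V W' \<Longrightarrow>
    (\<And>x. x \<le> n \<Longrightarrow> W' x \<subseteq> W x) \<Longrightarrow> W' \<le> W"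
    using finitely_generated_determined_below[OF assms] by blast
  have "\<exists>h :: 'v set \<Rightarrow> nat. (\<forall>W. VectorSpace.subspace K W (Space V x) \<longrightarrow> h W \<le> vectorspace.dim K (Space V x)) \<and>
    (\<forall>W W'. VectorSpace.subspace K W (Space V x) \<longrightarrow> VectorSpace.subspace K W' (Space V x) \<longrightarrow>
      W \<subset> W' \<longrightarrow> h W < h W')" for x
    using vectorspace.subspace_height[OF Space_vectorspace, of x] finitely_generated_dim_bound[OF assms]
    by metis
  then obtain h :: "nat \<Rightarrow> 'v set \<Rightarrow> nat" where
    h_le: "\<And>x W. VectorSpace.subspace K W (Space V x) \<Longrightarrow> h x W \<le> vectorspace.dim K (Space V x)" and
    h_less: "\<And>x W W'. VectorSpace.subspace K W (Space V x) \<Longrightarrow> VectorSpace.subspace K W' (Space V x) \<Longrightarrow>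
      W \<subset> W' \<Longrightarrow> h x W < h x W'"
    by metis
  define H where "H W = (\<Sum>x\<le>n. h x (W x))" for W
  have C_sub: "VectorSpace.subspace K (W x) (Space V x)" if "W \<in> C" for W x
    using that sub by (auto simp: subrepresentation_mats)
  have eq: "W = W'" if W: "W \<in> C" and W': "W' \<in> C" and le: "W \<le> W'" and H: "H W = H W'" for W W'
  proof (rule antisym[OF le], rule det)
    have le_x: "h x (W x) \<le> h x (W' x)" for x
      using h_less[OF C_sub[OF W, of x] C_sub[OF W', of x]] le
      by (cases "W x = W' x") (auto simp: le_fun_def less_le)
    show "W' x \<subseteq> W x" if x: "x \<le> n" for x
    proof (rule ccontr)
      assume "\<not> W' x \<subseteq> W x"
      then have "W x \<subset> W' x" using le by (auto simp: le_fun_def)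
      then have "h x (W x) < h x (W' x)" using h_less C_sub W W' by blast
      then have "H W < H W'"
        unfolding H_def using le_x x by (intro sum_strict_mono_ex1) auto
      with H show False by simp
    qed
  qed (use W W' sub in auto)
  have "inj_on H C"
  proof (rule inj_onI)
    fix W W' assume W: "W \<in> C" "W' \<in> C" "H W = H W'"
    then have "W \<le> W' \<or> W' \<le> W"
      using chain by (auto simp: chain_def)
    then show "W = W'" using eq W by metis
  qed
  moreover have "H ` C \<subseteq> {..\<Sum>x\<le>n. vectorspace.dim K (Space V x)}"
    unfolding H_def using h_le C_sub by (auto intro!: sum_mono)
  then have "finite (H ` C)"
    by (rule finite_subset) simp
  ultimately show "finite C"
    using finite_imageD by blast
qed

end

theorem theorem3p2:
  assumes "infinite (UNIV :: 'f::field set)"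
  shows "dimension_zero (Rel :: (nat, 'r::{finite, idempotent_semiring} mat) category)
    (class_ring :: 'f ring) TYPE('v)"
  unfolding dimension_zero_def
  using Rel_representation.finitely_generated_finite_length
  by (auto simp: Rel_representation_def)

end
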